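(* For every $c\in[0,1)$, $\phi_q(c)\to1$ as $q\to\infty$, where $q$ ranges over the integers $q\ge2$ and $c$ is fixed.
   Context: For an integer $q\ge2$ and $c\in[0,1)$ let $F_c^q=\{x\in[0,1) : \{q^nx\}\ge c\text{ for all integers } n\ge0\}$, where $\{\cdot\}$ denotes the fractional part, and let $\phi_q(c)=\dim_H F_c^q$ be its Hausdorff dimension. *)

theory Defs
  imports "HOL-Analysis.Analysis"
begin

text \<open>
  The weight of \<open>U\<close> is its diameter to the power \<open>s\<close>. Since \<open>0 powr 0 = 0\<close> in HOL, the case
  \<open>s = 0\<close> is separated, so that the \<open>0\<close>-dimensional measure is the counting measure.
\<close>

definition diam_power :: "real \<Rightarrow> 'a::metric_space set \<Rightarrow> ennreal" where
  "diam_power s U =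
    (if U = {} then 0 else if s = 0 then 1 else ennreal (diameter U powr s))"

text \<open>
  Boundedness is required explicitly because \<open>diameter\<close> is unspecified on unbounded sets.
  The members of a cover may be empty, so finite covers are included.
\<close>

definition delta_covers :: "real \<Rightarrow> 'a::metric_space set \<Rightarrow> (nat \<Rightarrow> 'a set) set" where
  "delta_covers \<delta> A = {U. A \<subseteq> (\<Union>i. U i) \<and> (\<forall>i. bounded (U i) \<and> diameter (U i) \<le> \<delta>)}"

definition hausdorff_premeasure :: "real \<Rightarrow> real \<Rightarrow> 'a::metric_space set \<Rightarrow> ennreal" where
  "hausdorff_premeasure s \<delta> A = (INF U\<in>delta_covers \<delta> A. \<Sum>i. diam_power s (U i))"

definition hausdorff_measure :: "real \<Rightarrow> 'a::metric_space set \<Rightarrow> ennreal" where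
  "hausdorff_measure s A = (SUP \<delta>\<in>{0<..}. hausdorff_premeasure s \<delta> A)"

text \<open>The dimension takes values in \<open>[0, \<infinity>]\<close>, and the empty set has dimension \<open>0\<close>.\<close>

definition hausdorff_dim :: "'a::metric_space set \<Rightarrow> ennreal" where
  "hausdorff_dim A = (INF s\<in>{s. 0 \<le> s \<and> hausdorff_measure s A = 0}. ennreal s)"

definition F :: "nat \<Rightarrow> real \<Rightarrow> real set" where
  "F q c = {x. 0 \<le> x \<and> x < 1 \<and> (\<forall>n::nat. frac (real q ^ n * x) \<ge> c)}"

definition phi :: "nat \<Rightarrow> real \<Rightarrow> ennreal" where
  "phi q c = hausdorff_dim (F q c)"

end

theory Submission
  imports Defs "HOL-Real_Asymp.Real_Asymp"
begin

text \<open>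
  The set \<open>F q c\<close> contains every number whose base-\<open>q\<close> digits all lie in
  \<open>{k..q - 2}\<close> with \<open>k = \<lceil>c q\<rceil>\<close>: multiplying by \<open>q\<close> shifts the digits, and a number
  with leading digit at least \<open>c q\<close> is at least \<open>c\<close>. The digit \<open>q - 1\<close> is discarded so that
  different digit sequences give quantitatively different numbers. There are
  \<open>m = q - 1 - k \<ge> (1 - c) q - 2\<close> admissible digits, so this Cantor set has dimension
  \<open>ln m / ln q\<close>, which tends to \<open>1\<close>. As \<open>F q c\<close> lies in the unit interval, its dimension is
  at most \<open>1\<close>, and the limit follows by squeezing.

  The lower bound for the dimension does not use a measure on the Cantor set. Reading the base-\<open>m\<close>
  digits of \<open>y \<in> [0,1)\<close> as base-\<open>q\<close> digits shifted by \<open>k\<close> gives a map \<open>g\<close> from \<open>[0,1)\<close> into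
  \<open>F q c\<close> whose inverse is Hoelder with exponent \<open>ln m / ln q\<close> (\<open>dist_le_dist_recode_powr\<close>).
  Pulling a cover of \<open>F q c\<close> back along \<open>g\<close> gives a cover of \<open>[0,1)\<close>, whose total length is at
  least \<open>1\<close>; this bounds the Hausdorff sum of the cover from below
  (\<open>hausdorff_dim_ge_of_Holder_inverse\<close>). The Hoelder estimate itself is a consequence of the
  functional equation \<open>q g(y) = k + \<lfloor>m y\<rfloor> + g({m y})\<close>.
\<close>

section \<open>Bounds for the Hausdorff dimension\<close>

text \<open>
  Covering \<open>[0,1)\<close> by \<open>N\<close> intervals of length \<open>1 / N\<close> gives the sum \<open>N powr (1 - s)\<close>, which
  tends to \<open>0\<close> for every \<open>s > 1\<close>.
\<close>

lemma hausdorff_dim_le_one: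
  fixes A :: "real set"
  assumes "A \<subseteq> {0..<1}"
  shows "hausdorff_dim A \<le> 1"
proof -
  have dim_le: "hausdorff_dim A \<le> ennreal s" if s: "s > 1" for s :: real
  proof -
    have "hausdorff_premeasure s \<delta> A = 0" if \<delta>: "\<delta> > 0" for \<delta> :: real
    proof -
      have le: "hausdorff_premeasure s \<delta> A \<le> ennreal (real N powr (1 - s))"
        if N: "N > 0" "1 / real N \<le> \<delta>" for N :: nat
      proof -
        define U :: "nat \<Rightarrow> real set" where
          "U i = (if i < N then {real i / N .. (real i + 1) / N} else {})" for i
        have diam: "diameter {real i / N .. (real i + 1) / N} = 1 / N" for i
        proof -
          have "real i / N \<le> (real i + 1) / N"
            by (intro divide_right_mono) auto
          then show ?thesis
            by (simp add: diff_divide_distrib[symmetric])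
        qed
        have "A \<subseteq> (\<Union>i. U i)"
        proof
          fix x assume "x \<in> A"
          then have x: "0 \<le> x" "x < 1" using assms by auto
          define i where "i = nat \<lfloor>x * N\<rfloor>"
          have nn: "0 \<le> x * N" using x by simp
          have "x * N < N" using x N by simp
          then have "i < N" unfolding i_def using nn by linarith
          moreover have "real i \<le> x * N" "x * N \<le> real i + 1"
            unfolding i_def using nn by linarith+
          then have "real i / N \<le> x" "x \<le> (real i + 1) / N"
            using N by (auto simp: field_simps)
          ultimately show "x \<in> (\<Union>i. U i)" by (auto simp: U_def)
        qed
        moreover have "bounded (U i) \<and> diameter (U i) \<le> \<delta>" for i
          using diam[of i] N \<delta> by (auto simp: U_def)
        ultimately have "U \<in> delta_covers \<delta> A"
          by (auto simp: delta_covers_def)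
        then have "hausdorff_premeasure s \<delta> A \<le> (\<Sum>i. diam_power s (U i))"
          unfolding hausdorff_premeasure_def by (rule INF_lower)
        also have "\<dots> = (\<Sum>i<N. diam_power s (U i))"
          by (rule suminf_finite) (auto simp: U_def diam_power_def)
        also have "\<dots> \<le> (\<Sum>i<N. ennreal ((1 / N) powr s))"
          by (rule sum_mono) (use s diam in \<open>auto simp: U_def diam_power_def simp del: diameter_closed_interval\<close>)
        also have "\<dots> = ennreal (N * (1 / N) powr s)"
          by (simp add: ennreal_mult' ennreal_of_nat_eq_real_of_nat)
        also have "N * (1 / N) powr s = real N powr (1 - s)"
          using N by (simp add: powr_diff powr_divide)
        finally show ?thesis .
      qed
      have "(\<lambda>N::nat. real N powr (1 - s)) \<longlonglongrightarrow> 0"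
        using s by real_asymp
      then have "(\<lambda>N::nat. ennreal (real N powr (1 - s))) \<longlonglongrightarrow> ennreal 0"
        by (rule tendsto_ennrealI)
      moreover have "\<forall>\<^sub>F N::nat in sequentially. N > 0 \<and> 1 / real N \<le> \<delta>"
        using \<delta> by (intro eventually_conj eventually_gt_at_top) real_asymp
      then have "\<forall>\<^sub>F N::nat in sequentially.
          hausdorff_premeasure s \<delta> A \<le> ennreal (real N powr (1 - s))"
        by eventually_elim (use le in auto)
      ultimately have "hausdorff_premeasure s \<delta> A \<le> ennreal 0"
        by (intro tendsto_lowerbound) auto
      then show ?thesis by simp
    qed
    then have "hausdorff_measure s A = 0"
      unfolding hausdorff_measure_def by (intro antisym SUP_least) auto
    with s show ?thesis
      unfolding hausdorff_dim_def by (intro INF_lower) auto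
  qed
  have "(\<lambda>n::nat. ennreal (1 + 1 / real (Suc n))) \<longlonglongrightarrow> ennreal 1"
    by (intro tendsto_ennrealI) real_asymp
  then have "hausdorff_dim A \<le> ennreal 1"
  proof (rule tendsto_lowerbound)
    show "\<forall>\<^sub>F n::nat in sequentially. hausdorff_dim A \<le> ennreal (1 + 1 / real (Suc n))"
      by (intro always_eventually allI dim_le) simp
  qed simp
  then show ?thesis by simp
qed

text \<open>
  The preimage under \<open>g\<close> of a set \<open>U\<close> has diameter at most \<open>M\<close> times \<open>diameter U powr t\<close>,
  hence at most \<open>M\<close> times the \<open>s\<close>-weight of \<open>U\<close> when \<open>s < t\<close> and \<open>diameter U \<le> 1\<close>.
  Since the preimages of a cover of \<open>A\<close> cover an interval of length \<open>1\<close>, countable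
  subadditivity of Lebesgue measure keeps the Hausdorff sums away from \<open>0\<close>.
\<close>

lemma hausdorff_dim_ge_of_Holder_inverse:
  fixes A :: "'a::metric_space set" and g :: "real \<Rightarrow> 'a"
  assumes "M > 0" and "t > 0"
    and g_in: "\<And>y. y \<in> {0..<1} \<Longrightarrow> g y \<in> A"
    and Holder: "\<And>y z. y \<in> {0..<1} \<Longrightarrow> z \<in> {0..<1} \<Longrightarrow>
      dist y z \<le> M * dist (g y) (g z) powr t"
  shows "ennreal t \<le> hausdorff_dim A"
proof -
  have "t \<le> s" if s: "0 \<le> s" and null: "hausdorff_measure s A = 0" for s
  proof (rule ccontr)
    assume "\<not> t \<le> s"
    then have st: "s < t" by simp
    have sum_ge: "1 \<le> ennreal (2 * M) * (\<Sum>i. diam_power s (U i))"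
      if U: "U \<in> delta_covers 1 A" for U
    proof -
      define V where "V i = {y \<in> {0..<1}. g y \<in> U i}" for i
      have "\<exists>B. V i \<subseteq> B \<and> B \<in> sets lborel \<and>
          emeasure lborel B \<le> ennreal (2 * M) * diam_power s (U i)" for i
      proof (cases "V i = {}")
        case True
        then show ?thesis by (intro exI[of _ "{}"]) auto
      next
        case False
        then obtain y where y: "y \<in> V i" by auto
        have bd: "bounded (U i)" and d1: "diameter (U i) \<le> 1"
          using U by (auto simp: delta_covers_def)
        define d where "d = (if s = 0 then 1 else diameter (U i) powr s)"
        have d: "diam_power s (U i) = ennreal d" "0 \<le> d"
          using y by (auto simp: V_def d_def diam_power_def)
        have "dist y z \<le> M * d" if z: "z \<in> V i" for z
        proof -
          define r where "r = dist (g y) (g z)"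
          have r: "0 \<le> r" "r \<le> diameter (U i)"
            using diameter_bounded_bound[OF bd, of "g y" "g z"] y z
            by (auto simp: r_def V_def)
          have "r powr t \<le> r powr s"
            using r d1 st by (intro powr_mono') auto
          moreover have "r powr s \<le> d"
            using r s by (auto simp: d_def intro: powr_mono2)
          ultimately have "M * r powr t \<le> M * d"
            using \<open>M > 0\<close> by (intro mult_left_mono) auto
          then show ?thesis
            using Holder[of y z] y z by (auto simp: V_def r_def)
        qed
        then have "V i \<subseteq> {y - M * d .. y + M * d}"
          by (force simp: dist_real_def abs_le_iff)
        moreover have "emeasure lborel {y - M * d .. y + M * d} = ennreal (2 * M * d)"
          using d \<open>M > 0\<close> by (subst emeasure_lborel_Icc) auto
        ultimately show ?thesis
          using d \<open>M > 0\<close>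
          by (intro exI[of _ "{y - M * d .. y + M * d}"]) (auto simp: ennreal_mult)
      qed
      then obtain B where B: "\<And>i. V i \<subseteq> B i" "\<And>i. B i \<in> sets lborel"
        "\<And>i. emeasure lborel (B i) \<le> ennreal (2 * M) * diam_power s (U i)"
        by metis
      have "{0..<1} \<subseteq> (\<Union>i. B i)"
      proof
        fix y :: real assume y: "y \<in> {0..<1}"
        then obtain i where "g y \<in> U i"
          using g_in[OF y] U by (auto simp: delta_covers_def)
        with y B(1)[of i] show "y \<in> (\<Union>i. B i)" by (auto simp: V_def)
      qed
      then have "emeasure lborel {0..<1::real} \<le> emeasure lborel (\<Union>i. B i)"
        using B(2) by (intro emeasure_mono) auto
      also have "\<dots> \<le> (\<Sum>i. emeasure lborel (B i))"
        using B(2) by (intro emeasure_subadditive_countably) auto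
      also have "\<dots> \<le> (\<Sum>i. ennreal (2 * M) * diam_power s (U i))"
        using B(3) by (intro suminf_le) auto
      finally show ?thesis by simp
    qed
    have "ennreal (1 / (2 * M)) \<le> (\<Sum>i. diam_power s (U i))"
      if "U \<in> delta_covers 1 A" for U
    proof -
      have "ennreal (1 / (2 * M)) * 1
          \<le> ennreal (1 / (2 * M)) * (ennreal (2 * M) * (\<Sum>i. diam_power s (U i)))"
        using sum_ge[OF that]
        by (intro mult_left_mono) auto
      also have "\<dots> = (\<Sum>i. diam_power s (U i))"
        using \<open>M > 0\<close> by (simp add: mult.assoc[symmetric] ennreal_mult[symmetric])
      finally show ?thesis by simp
    qed
    then have "ennreal (1 / (2 * M)) \<le> hausdorff_premeasure s 1 A"
      unfolding hausdorff_premeasure_def by (intro INF_greatest) auto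
    also have "\<dots> \<le> hausdorff_measure s A"
      unfolding hausdorff_measure_def by (intro SUP_upper) auto
    finally show False
      using null \<open>M > 0\<close> by (simp add: ennreal_eq_0_iff)
  qed
  then show ?thesis
    unfolding hausdorff_dim_def by (intro INF_greatest) (auto intro: ennreal_leI)
qed

section \<open>Recoding base-\<open>m\<close> digits as base-\<open>q\<close> digits\<close>

text \<open>
  The strict inequality \<open>k + m < q\<close> keeps the recoded digits \<open>k, \<dots>, k + m - 1\<close> below \<open>q - 1\<close>.
\<close>

locale digit_recoding =
  fixes q k m :: nat
  assumes two_le_m: "2 \<le> m" and digits_bound: "k + m < q"
begin

definition recode :: "real \<Rightarrow> real" where
  "recode y = (\<Sum>i. (real k + real_of_int \<lfloor>m * frac (real m ^ i * y)\<rfloor>) / real q ^ Suc i)"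

lemma digit_bounds:
  shows "0 \<le> \<lfloor>real m * frac x\<rfloor>" and "real k + real_of_int \<lfloor>m * frac x\<rfloor> \<le> real q - 2"
proof -
  have "real m * frac x < m" using two_le_m frac_lt_1[of x] by simp
  then have "\<lfloor>real m * frac x\<rfloor> \<le> int m - 1" by linarith
  then show "real k + real_of_int \<lfloor>m * frac x\<rfloor> \<le> real q - 2" using digits_bound by linarith
qed simp

lemma sums_geometric_digits: "(\<lambda>i. a / real q ^ Suc i) sums (a / (real q - 1))"
proof -
  have "(\<lambda>i. (1 / real q) ^ i) sums (1 / (1 - 1 / real q))"
    using two_le_m digits_bound by (intro geometric_sums) auto
  from sums_mult[OF this, of "a / q"] show ?thesis
    using two_le_m digits_bound by (simp add: field_simps)
qed

lemma summable_recode: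
  "summable (\<lambda>i. (real k + real_of_int \<lfloor>m * frac (real m ^ i * y)\<rfloor>) / real q ^ Suc i)"
proof (rule summable_comparison_test'[OF sums_summable[OF sums_geometric_digits[of "real q - 2"]]])
  fix i :: nat
  show "norm ((real k + real_of_int \<lfloor>m * frac (real m ^ i * y)\<rfloor>) / real q ^ Suc i)
      \<le> (real q - 2) / real q ^ Suc i"
    using digit_bounds[of "real m ^ i * y"] by (auto intro!: divide_right_mono simp del: power_Suc)
qed

lemma recode_nonneg: "0 \<le> recode y"
  unfolding recode_def using digit_bounds(1)
  by (intro suminf_nonneg summable_recode)
    (auto intro!: divide_nonneg_nonneg add_nonneg_nonneg simp del: power_Suc)

lemma recode_le: "recode y \<le> (real q - 2) / (real q - 1)"
proof -
  have "recode y \<le> (\<Sum>i. (real q - 2) / real q ^ Suc i)"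
    unfolding recode_def
    by (intro suminf_le summable_recode sums_summable[OF sums_geometric_digits] divide_right_mono
        digit_bounds(2)) auto
  also have "\<dots> = (real q - 2) / (real q - 1)"
    by (rule sums_unique[OF sums_geometric_digits, symmetric])
  finally show ?thesis .
qed

lemma recode_less_one: "recode y < 1"
  proof -
  have "(real q - 2) / (real q - 1) < 1"
    using two_le_m digits_bound by (simp add: divide_less_eq)
  with recode_le[of y] show ?thesis by (rule le_less_trans)
qed

lemma recode_functional_equation:
  fixes y :: real
  assumes "0 \<le> y" "y < 1"
  shows "real q * recode y = real k + real_of_int \<lfloor>m * y\<rfloor> + recode (frac (m * y))"
proof -
  have shift: "frac (real m ^ Suc i * y) = frac (real m ^ i * frac (m * y))" for i
  proof -
    have "real m ^ Suc i * y = real m ^ i * frac (m * y) + real_of_int (int m ^ i * \<lfloor>m * y\<rfloor>)"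
      by (simp add: frac_def algebra_simps)
    then show ?thesis by (simp only: frac_add_of_int_right)
  qed
  let ?a = "\<lambda>i. (real k + real_of_int \<lfloor>m * frac (real m ^ i * y)\<rfloor>) / real q ^ Suc i"
  have "recode y = ?a 0 + (\<Sum>i. ?a (Suc i))"
    unfolding recode_def using suminf_split_head[OF summable_recode[of y]] by simp
  also have "(\<Sum>i. ?a (Suc i)) = recode (frac (m * y)) / q"
  proof -
    have "?a (Suc i)
        = (real k + real_of_int \<lfloor>m * frac (real m ^ i * frac (m * y))\<rfloor>) / real q ^ Suc i / q" for i
      unfolding shift by simp
    then show ?thesis
      unfolding recode_def by (simp only: suminf_divide[OF summable_recode])
  qed
  also have "?a 0 = (real k + real_of_int \<lfloor>m * y\<rfloor>) / q"
    using assms by (simp add: frac_eq)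
  finally have "recode y = (real k + real_of_int \<lfloor>m * y\<rfloor> + recode (frac (m * y))) / q"
    by (simp add: add_divide_distrib)
  then show ?thesis using digits_bound by simp
qed

text \<open>
  Multiplication by \<open>q\<close> modulo \<open>1\<close> on the image corresponds to multiplication by \<open>m\<close> modulo \<open>1\<close>
  on the parameter, so the orbit of \<open>recode y\<close> stays in the image, where the leading digit
  forces a value of at least \<open>k / q\<close>.
\<close>

lemma recode_in_F:
  fixes c y :: real
  assumes "c * q \<le> k" "0 \<le> y" "y < 1"
  shows "recode y \<in> F q c"
proof -
  have "c \<le> frac (real q ^ n * recode y)" if "0 \<le> y" "y < 1" for n y
    using that
  proof (induction n arbitrary: y)
    case 0
    have "real k \<le> q * recode y"
      using recode_functional_equation[OF 0] recode_nonneg[of "frac (m * y)"] 0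
      by simp
    with assms(1) have "q * c \<le> q * recode y" by (simp add: mult.commute)
    then have "c \<le> recode y" using digits_bound by simp
    then show ?case
      using recode_nonneg[of y] recode_less_one[of y] by (simp add: frac_eq)
  next
    case (Suc n)
    have "real q ^ Suc n * recode y = real q ^ n * (q * recode y)" by simp
    also have "\<dots> = real q ^ n * recode (frac (m * y))
        + real_of_int (int q ^ n * (int k + \<lfloor>m * y\<rfloor>))"
      unfolding recode_functional_equation[OF Suc.prems] by (simp add: algebra_simps)
    finally have "frac (real q ^ Suc n * recode y) = frac (real q ^ n * recode (frac (m * y)))"
      by (simp only: frac_add_of_int_right)
    then show ?case using Suc.IH[of "frac (m * y)"] by (simp add: frac_lt_1)
  qed
  then show ?thesis
    using assms recode_nonneg recode_less_one by (auto simp: F_def)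
qed

text \<open>
  If the leading digits of \<open>y\<close> and \<open>z\<close> differ, then the images differ by at least one unit in the
  first base-\<open>q\<close> digit, minus a tail of at most \<open>(q - 2) / (q - 1)\<close> such units; the remaining gap
  exceeds \<open>1 / q\<^sup>2\<close>. If the leading digits agree, removing them multiplies the distances by
  \<open>m\<close> and by \<open>q\<close>.
\<close>

lemma dist_recode_ge:
  fixes y z :: real
  assumes "y \<in> {0..<1}" "z \<in> {0..<1}" "1 / real m ^ n < dist y z"
  shows "1 / real q ^ Suc n \<le> dist (recode y) (recode z)"
  using assms
proof (induction n arbitrary: y z)
  case 0
  then show ?case by (auto simp: dist_real_def)
next
  case (Suc n)
  have q: "real q > 2" using two_le_m digits_bound by linarith
  let ?y = "frac (m * y)" and ?z = "frac (m * z)"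
  define e where "e = \<lfloor>m * y\<rfloor> - \<lfloor>m * z\<rfloor>"
  have eq: "q * (recode y - recode z) = e + (recode ?y - recode ?z)"
    using recode_functional_equation[of y] recode_functional_equation[of z] Suc.prems
    by (simp add: e_def algebra_simps)
  have "1 / real q ^ Suc n \<le> \<bar>q * (recode y - recode z)\<bar>"
  proof (cases "e = 0")
    case True
    have "m * (y - z) = ?y - ?z"
      using True by (simp add: e_def frac_def algebra_simps)
    then have "dist ?y ?z = m * dist y z"
      by (metis abs_mult abs_of_nat dist_real_def)
    moreover have "m * (1 / real m ^ Suc n) < m * dist y z"
      using Suc.prems two_le_m by (intro mult_strict_left_mono) auto
    ultimately have "1 / real m ^ n < dist ?y ?z"
      using two_le_m by simp
    then have "1 / real q ^ Suc n \<le> dist (recode ?y) (recode ?z)"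
      by (intro Suc.IH) (auto simp: frac_lt_1)
    then show ?thesis using True eq by (simp add: dist_real_def)
  next
    case False
    have "1 / real q ^ Suc n \<le> 1 / q ^ 1"
      using q by (intro divide_left_mono power_increasing) auto
    also have "\<dots> \<le> 1 - (real q - 2) / (real q - 1)"
      using q by (simp add: field_simps)
    also have "\<dots> \<le> \<bar>q * (recode y - recode z)\<bar>"
    proof -
      have "1 \<le> \<bar>real_of_int e\<bar>" using False by linarith
      then show ?thesis
        unfolding eq using recode_nonneg[of ?y] recode_nonneg[of ?z] recode_le[of ?y] recode_le[of ?z]
        by linarith
    qed
    finally show ?thesis .
  qed
  then have "1 / real q ^ Suc n \<le> q * dist (recode y) (recode z)"
    by (simp add: dist_real_def abs_mult)
  then show ?case using q by (simp add: field_simps)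
qed

lemma dist_le_dist_recode_powr:
  assumes "y \<in> {0..<1}" "z \<in> {0..<1}"
  shows "dist y z \<le> real m ^ 2 * dist (recode y) (recode z) powr (ln m / ln q)"
proof (cases "y = z")
  case False
  have m: "real m > 1" and q: "real q > 1" using two_le_m digits_bound by linarith+
  define t where "t = ln m / ln q"
  have "t > 0" using m q by (simp add: t_def)
  have qt: "(1 / real q ^ j) powr t = 1 / real m ^ j" for j
  proof -
    have "real q powr t = m" using m q by (simp add: t_def powr_def)
    moreover have "(real q ^ j) powr t = (real q powr t) ^ j"
      using q by (simp add: powr_powr powr_power mult.commute flip: powr_realpow)
    ultimately show ?thesis using q by (simp add: powr_divide)
  qed
  \<comment> \<open>The scale \<open>n\<close> is the first one that separates \<open>y\<close> from \<open>z\<close>.\<close>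
  define n where "n = (LEAST n. 1 / real m ^ n < dist y z)"
  have "\<exists>n. (1 / real m) ^ n < dist y z"
    using False m by (intro real_arch_pow_inv) auto
  then have n: "1 / real m ^ n < dist y z"
    unfolding n_def power_one_over by (rule LeastI_ex)
  moreover have "dist y z < 1" using assms by (auto simp: dist_real_def)
  ultimately obtain j where j: "n = Suc j" by (cases n) auto
  then have "\<not> 1 / real m ^ j < dist y z"
    unfolding n_def by (metis lessI not_less_Least)
  then have "dist y z \<le> real m ^ 2 * (1 / real m ^ Suc n)"
    using m by (simp add: j power2_eq_square field_simps)
  also have "1 / real m ^ Suc n = (1 / real q ^ Suc n) powr t"
    by (rule qt[symmetric])
  also have "\<dots> \<le> dist (recode y) (recode z) powr t"
    using dist_recode_ge[OF assms n] \<open>t > 0\<close> by (intro powr_mono2) auto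
  finally show ?thesis using m by (simp add: t_def mult_left_mono)
qed simp

lemma phi_ge:
  fixes c :: real
  assumes "c * q \<le> k"
  shows "ennreal (ln m / ln q) \<le> phi q c"
  unfolding phi_def
proof (rule hausdorff_dim_ge_of_Holder_inverse[where g = recode])
  show "real m ^ 2 > 0" "ln m / ln q > 0" using two_le_m digits_bound by auto
qed (use assms recode_in_F dist_le_dist_recode_powr in auto)

end

section \<open>The limit\<close>

theorem corollary24:
  fixes c :: real
  assumes "0 \<le> c" and "c < 1"
  shows "(\<lambda>q::nat. phi q c) \<longlonglongrightarrow> 1"
proof (rule tendsto_sandwich)
  have pos: "1 - c > 0" using assms by simp
  have "(\<lambda>q::nat. ln ((1 - c) * real q - 2) / ln (real q)) \<longlonglongrightarrow> 1"
    using pos by real_asymp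
  then show "(\<lambda>q::nat. ennreal (ln ((1 - c) * real q - 2) / ln (real q))) \<longlonglongrightarrow> 1"
    using tendsto_ennrealI by fastforce
  have "\<forall>\<^sub>F q::nat in sequentially. (1 - c) * real q - 2 \<ge> 2"
    using pos by real_asymp
  then show "\<forall>\<^sub>F q::nat in sequentially. ennreal (ln ((1 - c) * real q - 2) / ln (real q)) \<le> phi q c"
  proof eventually_elim
    case (elim q)
    define k where "k = nat \<lceil>c * q\<rceil>"
    \<comment> \<open>The number of digits from \<open>k\<close> to \<open>q - 2\<close>.\<close>
    define m where "m = q - 1 - k"
    have cq: "0 \<le> c * q" using assms by simp
    then have k: "c * q \<le> k" "k < c * q + 1"
      unfolding k_def by linarith+
    have "real k + 3 < q" using elim k by (simp add: algebra_simps)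
    then have m: "real m = real q - 1 - k" unfolding m_def by linarith
    interpret digit_recoding q k m
      by unfold_locales (use m \<open>real k + 3 < q\<close> in linarith)+
    have "(1 - c) * q - 2 \<le> m" using m k by (simp add: algebra_simps)
    then have "ln ((1 - c) * q - 2) / ln q \<le> ln m / ln q"
      using elim \<open>real k + 3 < q\<close> by (intro divide_right_mono) auto
    then show ?case
      using phi_ge[OF k(1)] by (meson ennreal_leI order_trans)
  qed
  show "\<forall>\<^sub>F q::nat in sequentially. phi q c \<le> 1"
    by (intro always_eventually allI) (auto simp: phi_def F_def intro!: hausdorff_dim_le_one)
qed simp

end
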